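(* (Minkowski inequality) Let $p\in(1,\infty)$ and let $A$ and $B$ be weighted geometric mean closed Archimedean $\Phi$-algebras over $\mathbb{K}$. For every positive linear map $T\colon A\to B$, every $n\in\mathbb{N}$ and all $a_1,\dots,a_n\in A$, $\Bigl(T\bigl(\bigl|\sum_{k=1}^na_k\bigr|^p\bigr)\Bigr)^{1/p}\le\sum_{k=1}^n\bigl(T(|a_k|^p)\bigr)^{1/p}$.
   Context: $\mathbb{K}$ denotes $\mathbb{R}$ or $\mathbb{C}$. An Archimedean vector lattice over $\mathbb{C}$ is $E+iE$ where $E$ is an Archimedean real vector lattice in which $\sup\{(\cos\theta)f+(\sin\theta)g:\theta\in[0,2\pi]\}$ exists for all $f,g$, with modulus $|f+ig|$ equal to that supremum; over $\mathbb{R}$ it is an Archimedean real vector lattice with $|f|=f\vee(-f)$. $A^+=\{a:|a|=a\}$, $A_\rho=A^+-A^+$ with its real lattice order. An Archimedean $\Phi$-algebra over $\mathbb{K}$: $A_\rho$ is an $f$-algebra with multiplicative identity $e$ (multiplication extended complex-bilinearly in the complex case). $A$ is weighted geometric mean closed if for all $f_1,\dots,f_n\in A$, $r_k\in(0,1)$ with $\sum r_k=1$, $\inf\{\sum r_k\theta_k|f_k|:\theta_k>0,\ \prod\theta_k^{r_k}=1\}$ exists in $A$. For $a\in A^+$ and $r\in(0,\infty)$, with $\lfloor r\rfloor=\max\{n\in\mathbb{N}\cup\{0\}:n\le r\}$ and $\tilde r=r-\lfloor r\rfloor$, $a^r=a^{\lfloor r\rfloor}\inf\{\tilde r\theta_1a+(1-\tilde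 r)\theta_2e:\theta_1,\theta_2>0,\ \theta_1^{\tilde r}\theta_2^{1-\tilde r}=1\}$, with $a^0=e$ and the infimum taken to be $e$ when $\tilde r=0$. A linear map $T$ is positive if $T(A^+)\subseteq B^+$. *)

theory Defs
  imports Complex_Main "HOL-Library.Product_Plus"
begin

text \<open>An Archimedean real vector lattice which is an f-algebra with multiplicative
identity 1 (the element e of the paper). The unit is not required to differ from 0.\<close>

class phi_algebra = real_algebra + monoid_mult + lattice + ordered_real_vector +
  assumes archimedean: "(\<forall>n::nat. of_nat n *\<^sub>R a \<le> b) \<Longrightarrow> a \<le> 0"
  and mult_nonneg: "0 \<le> a \<Longrightarrow> 0 \<le> b \<Longrightarrow> 0 \<le> a * b"
  and f_algebra: "inf a b = 0 \<Longrightarrow> 0 \<le> c \<Longrightarrow> inf (c * a) b = 0 \<and> inf (a * c) b = 0"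

definition is_inf :: "'a::order set \<Rightarrow> 'a \<Rightarrow> bool" where
  "is_inf S s \<longleftrightarrow> (\<forall>x\<in>S. s \<le> x) \<and> (\<forall>u. (\<forall>x\<in>S. u \<le> x) \<longrightarrow> u \<le> s)"

definition is_sup :: "'a::order set \<Rightarrow> 'a \<Rightarrow> bool" where
  "is_sup S s \<longleftrightarrow> (\<forall>x\<in>S. x \<le> s) \<and> (\<forall>u. (\<forall>x\<in>S. x \<le> u) \<longrightarrow> s \<le> u)"

definition lmod :: "'a::phi_algebra \<Rightarrow> 'a" where
  "lmod f = sup f (- f)"

definition rpos :: "'a::phi_algebra set" where
  "rpos = {a. lmod a = a}"

definition lpow :: "'a::phi_algebra \<Rightarrow> real \<Rightarrow> 'a" where
  "lpow a r = a ^ nat \<lfloor>r\<rfloor> *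
     (if frac r = 0 then 1
      else (THE s. is_inf {(frac r * t1) *\<^sub>R a + ((1 - frac r) * t2) *\<^sub>R 1 | t1 t2.
                           t1 > 0 \<and> t2 > 0 \<and> t1 powr (frac r) * t2 powr (1 - frac r) = 1} s))"

text \<open>Weighted geometric mean closedness, relative to the modulus map M : A \<Rightarrow> A_rho.\<close>
definition wgm_closed :: "('x \<Rightarrow> 'e::phi_algebra) \<Rightarrow> bool" where
  "wgm_closed M \<longleftrightarrow>
    (\<forall>(n::nat) (f::nat \<Rightarrow> 'x) (r::nat \<Rightarrow> real).
       (\<forall>k<n. 0 < r k \<and> r k < 1) \<and> (\<Sum>k<n. r k) = 1 \<longrightarrow>
       (\<exists>s. is_inf {\<Sum>k<n. (r k * \<theta> k) *\<^sub>R M (f k) | \<theta>.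
                       (\<forall>k<n. \<theta> k > 0) \<and> (\<Prod>k<n. \<theta> k powr r k) = 1} s))"

section \<open>Complex case: A = E + iE, elements represented as pairs (f, g) = f + i g\<close>

definition cmod_set :: "'e::phi_algebra \<Rightarrow> 'e \<Rightarrow> 'e set" where
  "cmod_set f g = {cos \<theta> *\<^sub>R f + sin \<theta> *\<^sub>R g | \<theta>. 0 \<le> \<theta> \<and> \<theta> \<le> 2 * pi}"

definition complexifiable :: "'e::phi_algebra itself \<Rightarrow> bool" where
  "complexifiable _ \<longleftrightarrow> (\<forall>f g::'e. \<exists>s. is_sup (cmod_set f g) s)"

definition cmodE :: "'e::phi_algebra \<times> 'e \<Rightarrow> 'e" where
  "cmodE x = (THE s. is_sup (cmod_set (fst x) (snd x)) s)"

definition cmodC :: "'e::phi_algebra \<times> 'e \<Rightarrow> 'e \<times> 'e" where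
  "cmodC x = (cmodE x, 0)"

definition cpos :: "('e::phi_algebra \<times> 'e) set" where
  "cpos = {a. cmodC a = a}"

definition cscale :: "complex \<Rightarrow> 'e::phi_algebra \<times> 'e \<Rightarrow> 'e \<times> 'e" where
  "cscale c x = (Re c *\<^sub>R fst x - Im c *\<^sub>R snd x, Re c *\<^sub>R snd x + Im c *\<^sub>R fst x)"

definition clinear_map :: "('e::phi_algebra \<times> 'e \<Rightarrow> 'f::phi_algebra \<times> 'f) \<Rightarrow> bool" where
  "clinear_map T \<longleftrightarrow> (\<forall>x y. T (x + y) = T x + T y) \<and> (\<forall>c x. T (cscale c x) = cscale c (T x))"

text \<open>Power of an element of A+ = {(f,0) | f \<ge> 0}: (f,0)^r = (f^r, 0), the power being
computed in A_rho = E (complex-bilinear multiplication restricted to E).\<close>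
definition cpow :: "'e::phi_algebra \<times> 'e \<Rightarrow> real \<Rightarrow> 'e \<times> 'e" where
  "cpow x r = (lpow (fst x) r, 0)"

text \<open>Order of A_rho = E, embedded as {(f,0)}.\<close>
definition cle :: "'e::phi_algebra \<times> 'e \<Rightarrow> 'e \<times> 'e \<Rightarrow> bool" where
  "cle x y \<longleftrightarrow> snd x = 0 \<and> snd y = 0 \<and> fst x \<le> fst y"

end

theory Submission
  imports Defs "HOL-Library.Lattice_Algebras" "HOL-Analysis.Convex"
begin

text \<open>For \<open>0 < r < 1\<close> the root \<open>a\<^sup>r\<close> is by definition the infimum of the affine functions of \<open>a\<close>
  tangent to \<open>x \<mapsto> x\<^sup>r\<close>. Dually, for \<open>p > 1\<close> the power \<open>a\<^sup>p\<close> is the least upper bound of the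
  tangents \<open>p s\<^sup>p\<^sup>-\<^sup>1 a - (p - 1) s\<^sup>p\<close>. Given this, comparing tangents yields
  \<open>(a + b)\<^sup>p \<le> \<alpha>\<^sup>1\<^sup>-\<^sup>p a\<^sup>p + (1 - \<alpha>)\<^sup>1\<^sup>-\<^sup>p b\<^sup>p\<close> for all scalars \<open>0 < \<alpha> < 1\<close>, \<open>T\<close> may be applied, and comparing
  tangents of \<open>x \<mapsto> x\<^sup>1\<^sup>/\<^sup>p\<close> in the target turns this family of inequalities back into the triangle inequality.

  The description of \<open>a\<^sup>p\<close> as a supremum rests on a substitute for pointwise reasoning: to show
  \<open>F \<le> 0\<close> it suffices to show \<open>F v \<le> 0\<close> for those \<open>v \<ge> 0\<close> living where \<open>s \<le> a \<le> \<rho> s\<close>, with a fixed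
  ratio \<open>\<rho> > 1\<close>, and for those disjoint from \<open>a\<close>. On such \<open>v\<close> multiplication by \<open>a\<close> can be
  estimated by scalars.\<close>

\<comment> \<open>Disjointness, squares and nilpotents in an f-algebra\<close>
subclass (in phi_algebra) ordered_ring
proof
  fix a b c :: 'a
  assume "a \<le> b" "0 \<le> c"
  then show "c * a \<le> c * b" "a * c \<le> b * c"
    using mult_nonneg[of c "b - a"] mult_nonneg[of "b - a" c] by (simp_all add: algebra_simps)
qed

subclass (in phi_algebra) lattice_ab_group_add ..

text \<open>The f-algebra axiom applied twice makes \<open>a * b\<close> disjoint first from
  \<open>b\<close>, then from itself.\<close>

lemma disjoint_mult: "a * b = 0" if "inf a b = 0" for a b :: "'a::phi_algebra"
proof -
  have ab: "0 \<le> a" "0 \<le> b" using that by (metis inf_le1, metis inf_le2)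
  have "inf (a * b) b = 0" using f_algebra[OF that ab(2)] by simp
  then have "inf b (a * b) = 0" by (simp add: inf.commute)
  from f_algebra[OF this ab(1)] show ?thesis by simp
qed

lemma pprt_diff: "x = pprt x - pprt (- x)" for x :: "'a::phi_algebra"
  using prts[of x] by (simp add: pprt_neg)

lemma inf_pprt: "inf (pprt x) (pprt (- x)) = 0" for x :: "'a::phi_algebra"
proof -
  have "inf (pprt x) (pprt (- x)) - pprt (- x) = inf (pprt x - pprt (- x)) 0"
    using add_inf_distrib_right[of "pprt x" "pprt (- x)" "- pprt (- x)"] by simp
  also have "\<dots> = nprt x" by (simp add: nprt_def flip: pprt_diff)
  finally show ?thesis by (simp add: pprt_neg)
qed

lemma inf_zero_mono: "inf x' y' = 0" if "inf x y = 0" "0 \<le> x'" "x' \<le> x" "0 \<le> y'" "y' \<le> y"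
  for x :: "'a::phi_algebra"
  by (metis that inf_mono le_inf_iff order_antisym)

text \<open>The positive and negative parts of \<open>x\<close> annihilate each other, so only their
  squares survive.\<close>

lemma square_nonneg: "0 \<le> x * x" for x :: "'a::phi_algebra"
proof -
  define P N where "P = pprt x" and "N = pprt (- x)"
  have "P * N = 0" "N * P = 0"
    using disjoint_mult inf_pprt[of x] inf.commute unfolding P_def N_def by metis+
  then have "x * x = P * P + N * N"
    by (subst (1 2) pprt_diff[of x]) (simp add: P_def N_def algebra_simps)
  then show ?thesis by (simp add: P_def N_def mult_nonneg)
qed

lemma one_nonneg: "0 \<le> (1 :: 'a::phi_algebra)"
  using square_nonneg[of "1::'a"] by simp

lemma archimedean_Suc: "a \<le> 0" if "\<And>n::nat. of_nat (Suc n) *\<^sub>R a \<le> b" "0 \<le> b" for a b :: "'a::phi_algebra"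
proof (rule archimedean, intro allI)
  fix n :: nat show "of_nat n *\<^sub>R a \<le> b"
    using that by (cases n) auto
qed

text \<open>As \<open>w * w = 0\<close>, the square of \<open>1 - n w\<close> is
  \<open>1 - 2 n w\<close>. Hence all multiples of \<open>w\<close> lie below the unit, and the
  Archimedean property applies.\<close>

lemma square_eq_0: "w = 0" if "0 \<le> w" "w * w \<le> 0" for w :: "'a::phi_algebra"
proof (rule antisym)
  show "w \<le> 0"
  proof (rule archimedean, intro allI)
    fix n :: nat
    let ?n = "of_nat n :: real"
    have "w * w = 0" using that mult_nonneg[of w w] by (simp add: antisym)
    then have "0 \<le> 1 - (2 * ?n) *\<^sub>R w"
      using square_nonneg[of "1 - ?n *\<^sub>R w"]
      by (simp add: algebra_simps scaleR_2 flip: scaleR_scaleR)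
    moreover have "?n *\<^sub>R w \<le> (2 * ?n) *\<^sub>R w"
      using that by (intro scaleR_right_mono) auto
    ultimately show "?n *\<^sub>R w \<le> 1" by simp
  qed
qed (fact that)

lemma inf_add_le: "inf y (u + v) \<le> inf y u + inf y v" if "0 \<le> y" "0 \<le> u" "0 \<le> v" for y :: "'a::phi_algebra"
proof -
  have "inf y (u + v) \<le> y + inf y v" "inf y (u + v) \<le> u + inf y v"
    using that by (auto simp: add_inf_distrib_left intro: le_infI1 le_infI2 add_increasing add_increasing2)
  then show ?thesis by (simp add: add_inf_distrib_right)
qed

lemma eq_0_if_inf_scaleR_1: "y = 0" if "inf y (\<delta> *\<^sub>R 1) = 0" "0 < \<delta>" for y :: "'a::phi_algebra"
  using disjoint_mult[OF that(1)] that(2) by simp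

section \<open>Localisation to regions where \<open>a\<close> is nearly constant\<close>

text \<open>In a representation by functions, \<open>v\<close> is supported where \<open>s \<le> a \<le> t\<close>.\<close>

definition between :: "'a::phi_algebra \<Rightarrow> real \<Rightarrow> real \<Rightarrow> 'a \<Rightarrow> bool" where
  "between a s t v \<longleftrightarrow> 0 \<le> v \<and> inf (pprt (s *\<^sub>R 1 - a)) v = 0 \<and> inf (pprt (a - t *\<^sub>R 1)) v = 0"

lemma between_mult: "between a s t (c * v)" if "between a s t v" "0 \<le> c"
  using that f_algebra[of v _ c] by (auto simp: between_def mult_nonneg inf.commute[of "pprt _"])

text \<open>The positive part of \<open>s - a\<close> dominates \<open>s - a\<close> and annihilates
  \<open>v\<close>; likewise for \<open>a - t\<close>.\<close>

lemma between_le: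
  assumes "between a s t v"
  shows "s *\<^sub>R v \<le> a * v" "a * v \<le> t *\<^sub>R v"
proof -
  have v: "0 \<le> v" and 0: "pprt (s *\<^sub>R 1 - a) * v = 0" "pprt (a - t *\<^sub>R 1) * v = 0"
    using assms by (auto simp: between_def intro: disjoint_mult)
  have "(s *\<^sub>R 1 - a) * v \<le> pprt (s *\<^sub>R 1 - a) * v" "(a - t *\<^sub>R 1) * v \<le> pprt (a - t *\<^sub>R 1) * v"
    using v by (auto intro!: mult_right_mono simp: pprt_def)
  then show "s *\<^sub>R v \<le> a * v" "a * v \<le> t *\<^sub>R v"
    unfolding 0 by (simp_all add: algebra_simps)
qed

lemma between_power:
  assumes "between a s t v" "0 \<le> a" "0 \<le> s" "0 \<le> t"
  shows "s ^ k *\<^sub>R v \<le> a ^ k * v \<and> a ^ k * v \<le> t ^ k *\<^sub>R v"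
proof (induction k)
  case (Suc k)
  have "0 \<le> a ^ k" by (induction k) (auto simp: one_nonneg mult_nonneg assms)
  then have b: "between a s t (a ^ k * v)" by (rule between_mult[OF assms(1)])
  have "s *\<^sub>R s ^ k *\<^sub>R v \<le> s *\<^sub>R (a ^ k * v)"
    by (rule scaleR_left_mono[OF conjunct1[OF Suc] assms(3)])
  moreover have "t *\<^sub>R (a ^ k * v) \<le> t *\<^sub>R t ^ k *\<^sub>R v"
    by (rule scaleR_left_mono[OF conjunct2[OF Suc] assms(4)])
  ultimately show ?case using between_le[OF b] by (auto simp: mult.assoc)
qed simp

text \<open>The positive part \<open>G\<close> of \<open>F\<close> is removed region by region: on
  short ranges of values of \<open>a\<close> by \<open>loc\<close>, on longer ones by gluing, above
  each \<open>s > 0\<close> by the Archimedean property. The rest of \<open>G\<close> is disjoint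
  from \<open>a\<close> and falls to \<open>zero\<close>.\<close>

lemma le_0_local:
  fixes F :: "'a::phi_algebra"
  assumes a: "0 \<le> a" and \<rho>: "1 < \<rho>"
    and loc: "\<And>s v. 0 < s \<Longrightarrow> between a s (\<rho> * s) v \<Longrightarrow> F * v \<le> 0"
    and zero: "\<And>v. 0 \<le> v \<Longrightarrow> inf a v = 0 \<Longrightarrow> F * v \<le> 0"
  shows "F \<le> 0"
proof -
  define G where "G = pprt F"
  have G: "0 \<le> G" "F \<le> G" by (auto simp: G_def pprt_def)
  \<comment> \<open>Below \<open>G\<close> the negative part of \<open>F\<close> has no effect, so
    \<open>v * v \<le> G * v = F * v \<le> 0\<close>.\<close>
  have key: "v = 0" if "0 \<le> v" "v \<le> G" "F * v \<le> 0" for v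
  proof (rule square_eq_0)
    have "inf (pprt (- F)) v = 0"
      using inf_pprt[of F] that by (metis G_def inf.commute inf_zero_mono order_refl zero_le_pprt)
    then have "F * v = G * v"
      by (subst pprt_diff[of F]) (simp add: G_def disjoint_mult algebra_simps)
    moreover have "v * v \<le> G * v" using that by (intro mult_right_mono)
    ultimately show "v * v \<le> 0" using that(3) by simp
  qed fact
  \<comment> \<open>\<open>L s\<close> and \<open>U t\<close> stand in for the indicators of
    \<open>a > s\<close> and \<open>a < t\<close>; \<open>Z s t\<close> says that \<open>G\<close>
    vanishes where \<open>s < a < t\<close>.\<close>
  define L where "L s = pprt (a - s *\<^sub>R 1)" for s
  define U where "U t = pprt (t *\<^sub>R 1 - a)" for t
  define Z where "Z s t \<longleftrightarrow> inf (inf G (L s)) (U t) = 0" for s t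
  have nn: "0 \<le> L s" "0 \<le> U s" for s by (auto simp: L_def U_def)
  have short: "Z s (\<rho> * s)" if "0 < s" for s
    unfolding Z_def
  proof (rule key)
    let ?v = "inf (inf G (L s)) (U (\<rho> * s))"
    show v: "0 \<le> ?v" "?v \<le> G" using G nn by (auto intro: le_infI1)
    have "inf (pprt (s *\<^sub>R 1 - a)) (L s) = 0" "inf (pprt (a - (\<rho> * s) *\<^sub>R 1)) (U (\<rho> * s)) = 0"
      using inf_pprt[of "s *\<^sub>R 1 - a"] inf_pprt[of "a - (\<rho> * s) *\<^sub>R 1"] by (simp_all add: L_def U_def)
    then have "between a s (\<rho> * s) ?v"
      using v(1) unfolding between_def
      by (intro conjI inf_zero_mono[OF _ zero_le_pprt order_refl v(1)]) (auto intro: le_infI1)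
    then show "F * ?v \<le> 0" by (rule loc[OF that])
  qed
  \<comment> \<open>The ranges overlap, so \<open>U t + L s'\<close> exceeds a positive multiple of
    the unit, and an element disjoint from that multiple is zero.\<close>
  have merge: "Z s t'" if "Z s t" "Z s' t'" "s < s'" "s' < t" "t < t'" for s s' t t'
    unfolding Z_def
  proof (rule eq_0_if_inf_scaleR_1)
    let ?y = "inf (inf G (L s)) (U t')"
    have y: "0 \<le> ?y" using G nn by simp
    have "(t - s') *\<^sub>R 1 \<le> U t + L s'"
      using add_mono[of "t *\<^sub>R 1 - a" "U t" "a - s' *\<^sub>R 1" "L s'"] by (simp add: U_def L_def pprt_def algebra_simps)
    then have "inf ?y ((t - s') *\<^sub>R 1) \<le> inf ?y (U t + L s')" by (rule inf_mono[OF order_refl])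
    also have "\<dots> \<le> inf ?y (U t) + inf ?y (L s')" by (rule inf_add_le[OF y nn(2,1)])
    also have "inf ?y (U t) \<le> inf (inf G (L s)) (U t)" by (rule inf_mono[OF inf_le1 order_refl])
    also have "\<dots> = 0" using that(1) by (simp add: Z_def)
    also have "inf ?y (L s') \<le> inf (inf G (L s')) (U t')" by (auto intro: le_infI1)
    also have "\<dots> = 0" using that(2) by (simp add: Z_def)
    finally have "inf ?y ((t - s') *\<^sub>R 1) \<le> 0" by simp
    moreover have "0 \<le> inf ?y ((t - s') *\<^sub>R 1)"
      using y that by (simp add: one_nonneg scaleR_nonneg_nonneg)
    ultimately show "inf ?y ((t - s') *\<^sub>R 1) = 0" by (rule antisym)
    show "0 < t - s'" using that by simp
  qed
  \<comment> \<open>Ranges of ratio \<open>\<rho>\<close> shifted by its square root overlap and can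
    be glued. The exponent \<open>k + 2\<close> makes \<open>k = 0\<close> a single such
    range.\<close>
  define \<sigma> where "\<sigma> = sqrt \<rho>"
  have \<sigma>: "1 < \<sigma>" "\<rho> = \<sigma> * \<sigma>" using \<rho> by (auto simp: \<sigma>_def)
  have chain: "Z s (s * \<sigma> ^ (k + 2))" if "0 < s" for s k
  proof (induction k)
    case 0
    then show ?case using short[OF that] by (simp add: \<sigma> mult_ac power2_eq_square)
  next
    case (Suc k)
    have "Z (s * \<sigma> ^ (k + 1)) (s * \<sigma> ^ (Suc k + 2))"
      using short[of "s * \<sigma> ^ (k + 1)"] that \<sigma> by (simp add: mult_ac)
    moreover have "s < s * \<sigma> ^ (k + 1)" "s * \<sigma> ^ (k + 1) < s * \<sigma> ^ (k + 2)" "s * \<sigma> ^ (k + 2) < s * \<sigma> ^ (Suc k + 2)"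
      using that \<sigma> by (auto intro: one_less_power power_strict_increasing simp del: power_Suc)
    ultimately show ?case using merge[OF Suc] by blast
  qed
  have low: "inf G (L s) = 0" if "0 < s" for s
  proof (rule antisym)
    let ?y = "inf G (L s)"
    have y: "0 \<le> ?y" using G nn by simp
    \<comment> \<open>The upper ends of the glued ranges are unbounded, so \<open>?y * a\<close>
      dominates every natural multiple of \<open>?y\<close>.\<close>
    show "?y \<le> 0"
    proof (rule archimedean, intro allI)
      fix n :: nat
      obtain k where k: "of_nat n / s < \<sigma> ^ k" using real_arch_pow[OF \<sigma>(1)] by blast
      let ?t = "s * \<sigma> ^ (k + 2)"
      have "\<sigma> ^ k \<le> \<sigma> ^ (k + 2)" using \<sigma>(1) by (intro power_increasing) auto
      then have n: "of_nat n \<le> ?t" using k that by (simp add: pos_divide_less_eq mult.commute order_trans less_imp_le del: power_add) (smt (verit) mult_left_mono)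
      have "?y * (?t *\<^sub>R 1 - a) \<le> ?y * U ?t" using y by (intro mult_left_mono) (auto simp: U_def pprt_def)
      also have "\<dots> = 0" using chain[OF that] unfolding Z_def by (rule disjoint_mult)
      finally have "?t *\<^sub>R ?y \<le> ?y * a" by (simp add: right_diff_distrib)
      moreover have "of_nat n *\<^sub>R ?y \<le> ?t *\<^sub>R ?y" using n y by (rule scaleR_right_mono)
      ultimately show "of_nat n *\<^sub>R ?y \<le> ?y * a" by simp
    qed
  qed (use G nn in simp)
  \<comment> \<open>Being disjoint from every \<open>L s\<close>, \<open>G\<close> lives where
    \<open>a \<le> s\<close> for all \<open>s > 0\<close>, so \<open>G * a\<close> lies below
    arbitrarily small multiples of \<open>G\<close>.\<close>
  have "G * a \<le> 0"
  proof (rule archimedean_Suc)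
    fix n :: nat
    let ?s = "inverse (of_nat (Suc n)) :: real"
    have "G * (a - ?s *\<^sub>R 1) \<le> G * L ?s" using G by (intro mult_left_mono) (auto simp: L_def pprt_def)
    also have "\<dots> = 0" by (rule disjoint_mult[OF low]) simp
    finally have "G * a \<le> ?s *\<^sub>R G" by (simp add: right_diff_distrib)
    then have "of_nat (Suc n) *\<^sub>R (G * a) \<le> of_nat (Suc n) *\<^sub>R ?s *\<^sub>R G" by (rule scaleR_left_mono) simp
    then show "of_nat (Suc n) *\<^sub>R (G * a) \<le> G" by (simp del: of_nat_Suc)
  qed (fact G)
  moreover have "inf a G * inf a G \<le> G * a"
    using a G by (intro mult_mono) auto
  ultimately have "inf a G = 0" using a G by (intro square_eq_0) auto
  then have "G = 0" using G zero by (intro key) auto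
  with G show ?thesis by simp
qed

text \<open>Estimates of powers on a piece of ratio \<open>\<rho>\<close> carry an error that
  disappears only as \<open>\<rho>\<close> tends to 1. Subtracting small multiples of
  \<open>R\<close> from \<open>F\<close> absorbs it, and the Archimedean property then removes
  \<open>R\<close>.\<close>

lemma le_0_local_approx:
  fixes F :: "'a::phi_algebra"
  assumes a: "0 \<le> a" and R: "0 \<le> R"
    and loc: "\<And>\<epsilon>. 0 < \<epsilon> \<Longrightarrow> \<exists>\<rho>>1. \<forall>s v. 0 < s \<longrightarrow> between a s (\<rho> * s) v \<longrightarrow> F * v \<le> \<epsilon> *\<^sub>R (R * v)"
    and zero: "\<And>v. 0 \<le> v \<Longrightarrow> inf a v = 0 \<Longrightarrow> F * v \<le> 0"
  shows "F \<le> 0"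
proof (rule archimedean_Suc[OF _ R])
  fix n :: nat
  let ?e = "inverse (of_nat (Suc n)) :: real"
  obtain \<rho> where \<rho>: "1 < \<rho>" "\<And>s v. 0 < s \<Longrightarrow> between a s (\<rho> * s) v \<Longrightarrow> F * v \<le> ?e *\<^sub>R (R * v)"
    using loc[of ?e] by auto
  have "F - ?e *\<^sub>R R \<le> 0"
  proof (rule le_0_local[OF a \<rho>(1)])
    show "(F - ?e *\<^sub>R R) * v \<le> 0" if "0 < s" "between a s (\<rho> * s) v" for s v
      using \<rho>(2)[OF that] by (simp add: left_diff_distrib)
    show "(F - ?e *\<^sub>R R) * v \<le> 0" if "0 \<le> v" "inf a v = 0" for v
    proof -
      have "0 \<le> ?e *\<^sub>R (R * v)" by (intro scaleR_nonneg_nonneg mult_nonneg R that) simp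
      with zero[OF that] show ?thesis by (simp add: left_diff_distrib)
    qed
  qed
  then have "of_nat (Suc n) *\<^sub>R F \<le> of_nat (Suc n) *\<^sub>R ?e *\<^sub>R R" by (intro scaleR_left_mono) auto
  then show "of_nat (Suc n) *\<^sub>R F \<le> R" by (simp del: of_nat_Suc)
qed

section \<open>Tangents of scalar powers, and roots as infima of tangents\<close>

lemma bernoulli_powr:
  fixes p s t :: real
  assumes "1 < p" "0 < s" "0 < t"
  shows "p * s powr (p - 1) * t - (p - 1) * s powr p \<le> t powr p"
proof -
  \<comment> \<open>Young's inequality with the conjugate weights \<open>1 / p\<close> and
    \<open>1 - 1 / p\<close>; multiplied by \<open>p\<close> it becomes the tangent
    inequality.\<close>
  have "(t powr p) powr (1 / p) * (s powr p) powr (1 - 1 / p) \<le> 1 / p * t powr p + (1 - 1 / p) * s powr p"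
    using assms by (intro Youngs_inequality_0) auto
  moreover have "(t powr p) powr (1 / p) = t" "(s powr p) powr (1 - 1 / p) = s powr (p - 1)"
    using assms by (simp_all add: powr_powr right_diff_distrib)
  ultimately have "t * s powr (p - 1) \<le> 1 / p * t powr p + (1 - 1 / p) * s powr p" by simp
  then have "p * (t * s powr (p - 1)) \<le> p * (1 / p * t powr p + (1 - 1 / p) * s powr p)"
    using assms by (intro mult_left_mono) auto
  also have "\<dots> = t powr p + (p - 1) * s powr p" using assms by (simp add: field_simps)
  finally show ?thesis by (simp add: mult_ac)
qed

text \<open>The affine functions tangent to the concave function \<open>a \<mapsto> a\<^sup>r\<close>; substituting
  \<open>s = t\<^sub>2 / t\<^sub>1\<close> turns the family in the definition of \<open>lpow\<close> into this one.\<close>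

definition root_tangent :: "real \<Rightarrow> real \<Rightarrow> 'a::phi_algebra \<Rightarrow> 'a" where
  "root_tangent r s a = (r * s powr (r - 1)) *\<^sub>R a + ((1 - r) * s powr r) *\<^sub>R 1"

text \<open>Weighted geometric mean closedness for the pair of \<open>a\<close> and the unit,
  phrased without a modulus so as to serve both scalar fields.\<close>

definition roots_exist :: "'a::phi_algebra itself \<Rightarrow> bool" where
  "roots_exist _ \<longleftrightarrow>
    (\<forall>(a::'a) r. 0 \<le> a \<longrightarrow> 0 < r \<longrightarrow> r < 1 \<longrightarrow> (\<exists>c. is_inf {root_tangent r s a | s. 0 < s} c))"

lemma is_inf_unique: "is_inf S x \<Longrightarrow> is_inf S y \<Longrightarrow> x = y"
  by (auto simp: is_inf_def intro: antisym)

lemma root_tangent_set: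
  fixes a :: "'a::phi_algebra"
  assumes "0 < r" "r < 1"
  shows "{(r * t1) *\<^sub>R a + ((1 - r) * t2) *\<^sub>R 1 | t1 t2. t1 > 0 \<and> t2 > 0 \<and> t1 powr r * t2 powr (1 - r) = 1}
    = {root_tangent r s a | s. 0 < s}" (is "?L = ?R")
proof (rule antisym; rule subsetI)
  fix x assume "x \<in> ?L"
  then obtain t1 t2 where x: "x = (r * t1) *\<^sub>R a + ((1 - r) * t2) *\<^sub>R 1"
    and t: "t1 > 0" "t2 > 0" "t1 powr r * t2 powr (1 - r) = 1" by blast
  have l: "r * ln t1 + (1 - r) * ln t2 = 0"
    using t by (simp add: powr_def flip: exp_add)
  \<comment> \<open>The constraint makes \<open>(ln t1, ln t2)\<close> a multiple of
    \<open>(r - 1, r)\<close>, with factor \<open>ln (t2 / t1)\<close>.\<close>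
  have "ln t1 = (r - 1) * ln (t2 / t1)" "ln t2 = r * ln (t2 / t1)"
    using l t by (simp_all add: ln_div algebra_simps)
  then have "(t2 / t1) powr (r - 1) = exp (ln t1)" "(t2 / t1) powr r = exp (ln t2)"
    using t by (auto simp: powr_def)
  then have "x = root_tangent r (t2 / t1) a" using x t by (simp add: root_tangent_def)
  then show "x \<in> ?R" using t by (auto intro!: exI[of _ "t2 / t1"])
next
  fix x assume "x \<in> ?R"
  then obtain s where s: "x = root_tangent r s a" "0 < s" by blast
  have "(s powr (r - 1)) powr r * (s powr r) powr (1 - r) = 1"
    using s by (simp add: powr_powr algebra_simps flip: powr_add)
  with s show "x \<in> ?L"
    unfolding root_tangent_def mem_Collect_eq
    by - (rule exI[of _ "s powr (r - 1)"], rule exI[of _ "s powr r"], simp)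
qed

lemma is_inf_lpow:
  fixes a :: "'a::phi_algebra"
  assumes "roots_exist TYPE('a)" "0 \<le> a" "0 < r" "r < 1"
  shows "is_inf {root_tangent r s a | s. 0 < s} (lpow a r)"
proof -
  obtain c where c: "is_inf {root_tangent r s a | s. 0 < s} c"
    using assms unfolding roots_exist_def by blast
  have fl: "\<lfloor>r\<rfloor> = 0" using assms by (simp add: floor_eq_iff)
  then have "frac r = r" by (simp add: frac_def)
  then have "lpow a r = (THE s. is_inf {root_tangent r s a | s. 0 < s} s)"
    using assms fl by (simp add: lpow_def root_tangent_set)
  also have "\<dots> = c" using c is_inf_unique by blast
  finally show ?thesis using c by simp
qed

lemma lpow_le_root_tangent:
  fixes a :: "'a::phi_algebra"
  assumes "roots_exist TYPE('a)" "0 \<le> a" "0 < r" "r < 1" "0 < s"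
  shows "lpow a r \<le> root_tangent r s a"
  using is_inf_lpow[OF assms(1-4)] assms(5) unfolding is_inf_def by blast

lemma lpow_greatest:
  fixes a :: "'a::phi_algebra"
  assumes "roots_exist TYPE('a)" "0 \<le> a" "0 < r" "r < 1" "\<And>s. 0 < s \<Longrightarrow> x \<le> root_tangent r s a"
  shows "x \<le> lpow a r"
  using is_inf_lpow[OF assms(1-4)] assms(5) unfolding is_inf_def by blast

lemma lpow_root_mono:
  fixes a b :: "'a::phi_algebra"
  assumes "roots_exist TYPE('a)" "0 \<le> a" "a \<le> b" "0 < r" "r < 1"
  shows "lpow a r \<le> lpow b r"
proof (rule lpow_greatest)
  fix s :: real assume "0 < s"
  then have "lpow a r \<le> root_tangent r s a" using assms by (intro lpow_le_root_tangent)
  also have "\<dots> \<le> root_tangent r s b"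
    using assms by (auto simp: root_tangent_def intro!: scaleR_left_mono)
  finally show "lpow a r \<le> root_tangent r s b" .
qed (use assms in auto)

text \<open>Both bounds equal \<open>s powr r\<close> when \<open>a\<close> is \<open>s\<close>
  times the unit, so they pinch the root on a piece where \<open>a\<close> is close to
  \<open>s\<close>. The case \<open>r = 0\<close> is included because a fractional part may be
  zero.\<close>

lemma lpow_root_bounds:
  fixes a :: "'a::phi_algebra"
  assumes ex: "roots_exist TYPE('a)" and a: "0 \<le> a" and r: "0 \<le> r" "r < 1" and s: "0 < s"
  shows "lpow a r \<le> root_tangent r s a" "s powr (r - 1) *\<^sub>R inf a (s *\<^sub>R 1) \<le> lpow a r"
proof -
  let ?b = "inf a (s *\<^sub>R 1)"
  have lower: "s powr (r - 1) *\<^sub>R ?b \<le> root_tangent r t a" if t: "0 < t" for t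
  proof -
    \<comment> \<open>Young's inequality splits the factor of \<open>?b\<close> into two terms; one
      copy of \<open>?b\<close> is then bounded by \<open>a\<close>, the other by \<open>s\<close>
      times the unit.\<close>
    have "(t powr (r - 1)) powr r * (t powr r / s) powr (1 - r) = s powr (r - 1)"
      using s t by (simp add: powr_divide powr_powr powr_diff flip: powr_add)
    then have "s powr (r - 1) \<le> r * t powr (r - 1) + (1 - r) * (t powr r / s)"
      using Youngs_inequality_0[of r "1 - r" "t powr (r - 1)" "t powr r / s"] r s t by simp
    then have "s powr (r - 1) *\<^sub>R ?b \<le> (r * t powr (r - 1) + (1 - r) * (t powr r / s)) *\<^sub>R ?b"
      using a s by (intro scaleR_right_mono) (auto simp: one_nonneg intro: scaleR_nonneg_nonneg)
    also have "\<dots> = (r * t powr (r - 1)) *\<^sub>R ?b + ((1 - r) * (t powr r / s)) *\<^sub>R ?b"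
      by (rule scaleR_left_distrib)
    also have "\<dots> \<le> (r * t powr (r - 1)) *\<^sub>R a + ((1 - r) * (t powr r / s)) *\<^sub>R s *\<^sub>R 1"
      using r s by (intro add_mono scaleR_left_mono) auto
    also have "\<dots> = root_tangent r t a" using s by (simp add: root_tangent_def)
    finally show ?thesis .
  qed
  have "lpow a r \<le> root_tangent r s a \<and> s powr (r - 1) *\<^sub>R ?b \<le> lpow a r"
  proof (cases "r = 0")
    case True
    then show ?thesis using lower[OF s] s by (simp add: lpow_def root_tangent_def)
  next
    case False
    then show ?thesis
      using assms lower by (auto intro!: lpow_le_root_tangent lpow_greatest)
  qed
  then show "lpow a r \<le> root_tangent r s a" "s powr (r - 1) *\<^sub>R ?b \<le> lpow a r" by auto
qed

lemma lpow_root_nonneg: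
  fixes a :: "'a::phi_algebra"
  assumes "roots_exist TYPE('a)" "0 \<le> a" "0 \<le> r" "r < 1"
  shows "0 \<le> lpow a r"
proof -
  have "0 \<le> 1 powr (r - 1) *\<^sub>R inf a (1 *\<^sub>R 1)" using assms by (simp add: one_nonneg)
  also have "\<dots> \<le> lpow a r" by (rule lpow_root_bounds[OF assms]) simp
  finally show ?thesis .
qed

section \<open>Powers as an integer power times a root, and their local estimates\<close>

lemma lpow_eq: "lpow a p = a ^ nat \<lfloor>p\<rfloor> * lpow a (frac p)" if "0 \<le> p"
proof -
  have "\<lfloor>frac p\<rfloor> = 0" "frac (frac p) = frac p"
    by (simp_all add: floor_eq_iff frac_lt_1 frac_eq)
  then show ?thesis by (simp add: lpow_def)
qed

lemma power_nonneg: "0 \<le> a ^ k" if "0 \<le> a" for a :: "'a::phi_algebra"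
  using that by (induction k) (auto simp: one_nonneg mult_nonneg)

lemma lpow_nonneg:
  fixes a :: "'a::phi_algebra"
  assumes "roots_exist TYPE('a)" "0 \<le> a" "0 \<le> p"
  shows "0 \<le> lpow a p"
  unfolding lpow_eq[OF assms(3)]
  using assms by (intro mult_nonneg power_nonneg lpow_root_nonneg) (auto simp: frac_lt_1)

lemma inf_mult_between:
  assumes "between a s t v" "0 \<le> s"
  shows "inf a (s *\<^sub>R 1) * v = s *\<^sub>R v"
proof -
  have "inf a (s *\<^sub>R 1) = s *\<^sub>R 1 - pprt (s *\<^sub>R 1 - a)"
    unfolding pprt_def diff_sup_eq_inf by (simp add: add_inf_distrib_left)
  moreover have "pprt (s *\<^sub>R 1 - a) * v = 0"
    using assms by (auto simp: between_def intro: disjoint_mult)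
  ultimately show ?thesis by (simp add: left_diff_distrib)
qed

lemma between_nonneg: "between a s t v \<Longrightarrow> 0 \<le> v"
  by (simp add: between_def)

text \<open>The integer power is estimated by scalars, the root by \<open>lpow_root_bounds\<close>
  at \<open>s\<close>. The tangent above the root brings one more factor \<open>a\<close>, whence
  the exponent of \<open>\<rho>\<close> in the upper bound.\<close>

lemma lpow_between:
  fixes a :: "'a::phi_algebra"
  assumes ex: "roots_exist TYPE('a)" and a: "0 \<le> a" and p: "1 < p"
    and \<rho>: "1 < \<rho>" and s: "0 < s" and v: "between a s (\<rho> * s) v"
  shows "s powr p *\<^sub>R v \<le> lpow a p * v"
    and "lpow a p * v \<le> (\<rho> ^ Suc (nat \<lfloor>p\<rfloor>) * s powr p) *\<^sub>R v"
proof -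
  define m r where "m = nat \<lfloor>p\<rfloor>" and "r = frac p"
  have r: "0 \<le> r" "r < 1" by (simp_all add: r_def frac_lt_1)
  have pm: "p = real m + r" using p by (simp add: r_def m_def frac_def)
  have v0: "0 \<le> v" using v by (rule between_nonneg)
  have pw: "s powr r * s ^ m = s powr p"
    using s by (simp add: pm powr_add powr_realpow)
  have eq: "lpow a p * v = a ^ m * (lpow a r * v)"
    using p by (simp add: lpow_eq[of p] m_def r_def mult.assoc)
  note b = between_power[OF v a less_imp_le[OF s], of m] between_power[OF v a less_imp_le[OF s], of "Suc m"]
  have "s powr p *\<^sub>R v = s powr r *\<^sub>R s ^ m *\<^sub>R v" by (simp add: pw)
  also have "\<dots> \<le> s powr r *\<^sub>R (a ^ m * v)"
    using b(1) \<rho> s by (intro scaleR_left_mono) auto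
  also have "\<dots> = a ^ m * (s powr (r - 1) *\<^sub>R inf a (s *\<^sub>R 1) * v)"
    using s by (simp add: inf_mult_between[OF v] powr_diff)
  also have "\<dots> \<le> a ^ m * (lpow a r * v)"
    by (intro mult_left_mono mult_right_mono lpow_root_bounds[OF ex a r s] v0 power_nonneg a)
  finally show "s powr p *\<^sub>R v \<le> lpow a p * v" unfolding eq .
  have "a ^ m * (lpow a r * v) \<le> a ^ m * (root_tangent r s a * v)"
    by (intro mult_left_mono mult_right_mono lpow_root_bounds[OF ex a r s] v0 power_nonneg a)
  also have "\<dots> = (r * s powr (r - 1)) *\<^sub>R (a ^ Suc m * v) + ((1 - r) * s powr r) *\<^sub>R (a ^ m * v)"
    by (simp add: root_tangent_def distrib_right distrib_left power_Suc2 mult.assoc del: power_Suc)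
  also have "\<dots> \<le> (r * s powr (r - 1)) *\<^sub>R (\<rho> * s) ^ Suc m *\<^sub>R v + ((1 - r) * s powr r) *\<^sub>R (\<rho> * s) ^ m *\<^sub>R v"
    using b \<rho> s r by (intro add_mono scaleR_left_mono) auto
  also have "\<dots> = (r * s powr (r - 1) * (\<rho> * s) ^ Suc m + (1 - r) * s powr r * (\<rho> * s) ^ m) *\<^sub>R v"
    by (simp add: scaleR_left_distrib)
  also have "r * s powr (r - 1) * (\<rho> * s) ^ Suc m + (1 - r) * s powr r * (\<rho> * s) ^ m
      = (r * \<rho> ^ Suc m + (1 - r) * \<rho> ^ m) * s powr p"
    using s by (simp add: power_mult_distrib powr_diff field_simps flip: pw)
  also have "\<dots> *\<^sub>R v \<le> (\<rho> ^ Suc m * s powr p) *\<^sub>R v"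
  proof (intro scaleR_right_mono mult_right_mono v0)
    have "(1 - r) * \<rho> ^ m \<le> (1 - r) * \<rho> ^ Suc m"
      using \<rho> r by (intro mult_left_mono power_increasing) auto
    then show "r * \<rho> ^ Suc m + (1 - r) * \<rho> ^ m \<le> \<rho> ^ Suc m" by (simp add: algebra_simps)
  qed simp
  finally show "lpow a p * v \<le> (\<rho> ^ Suc (nat \<lfloor>p\<rfloor>) * s powr p) *\<^sub>R v" unfolding eq m_def .
qed

text \<open>The permitted error is the gap between the bounds of \<open>lpow_between\<close>. With
  \<open>k = floor p + 1\<close>, choosing \<open>\<rho> ^ k = 1 + \<epsilon>\<close> and using
  \<open>s powr p \<le> 1 + s ^ k\<close> bounds it by \<open>\<epsilon>\<close> times
  \<open>1 + a ^ k\<close> on all pieces at once.\<close>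

lemma le_0_local_powr:
  fixes F a :: "'a::phi_algebra"
  assumes a: "0 \<le> a" and p: "0 \<le> p"
    and loc: "\<And>\<rho> s v. 1 < \<rho> \<Longrightarrow> 0 < s \<Longrightarrow> between a s (\<rho> * s) v \<Longrightarrow>
      F * v \<le> ((\<rho> ^ Suc (nat \<lfloor>p\<rfloor>) - 1) * s powr p) *\<^sub>R v"
    and zero: "\<And>v. 0 \<le> v \<Longrightarrow> inf a v = 0 \<Longrightarrow> F * v \<le> 0"
  shows "F \<le> 0"
proof (rule le_0_local_approx[OF a, where R = "1 + a ^ Suc (nat \<lfloor>p\<rfloor>)"])
  let ?k = "Suc (nat \<lfloor>p\<rfloor>)"
  show "0 \<le> 1 + a ^ ?k" using power_nonneg[OF a, of ?k] one_nonneg by (rule add_nonneg_nonneg[rotated])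
  fix \<epsilon> :: real assume \<epsilon>: "0 < \<epsilon>"
  define \<rho> where "\<rho> = root ?k (1 + \<epsilon>)"
  have \<rho>: "1 < \<rho>" "\<rho> ^ ?k = 1 + \<epsilon>" using \<epsilon> by (auto simp: \<rho>_def simp del: power_Suc)
  show "\<exists>\<rho>>1. \<forall>s v. 0 < s \<longrightarrow> between a s (\<rho> * s) v \<longrightarrow> F * v \<le> \<epsilon> *\<^sub>R ((1 + a ^ ?k) * v)"
  proof (intro exI[of _ \<rho>] conjI allI impI)
    fix s :: real and v assume s: "0 < s" and v: "between a s (\<rho> * s) v"
    have v0: "0 \<le> v" using v by (rule between_nonneg)
    have "s powr p \<le> 1 + s ^ ?k"
    proof (cases "s \<le> 1")
      case True
      then have "s powr p \<le> 1" using s p by (simp add: powr_le1)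
      moreover have "0 \<le> s ^ ?k" using s by simp
      ultimately show ?thesis by linarith
    next
      case False
      then have "s powr p \<le> s powr real ?k" using p by (intro powr_mono) linarith+
      then show ?thesis using s by (simp add: powr_realpow del: power_Suc of_nat_Suc)
    qed
    then have "s powr p *\<^sub>R v \<le> (1 + s ^ ?k) *\<^sub>R v" using v0 by (rule scaleR_right_mono)
    also have "\<dots> \<le> (1 + a ^ ?k) * v"
      using between_power[OF v a, of ?k] s \<rho> by (simp add: scaleR_left_distrib distrib_right del: power_Suc)
    finally have "\<epsilon> *\<^sub>R s powr p *\<^sub>R v \<le> \<epsilon> *\<^sub>R ((1 + a ^ ?k) * v)"
      using \<epsilon> by (intro scaleR_left_mono) auto
    moreover have "F * v \<le> \<epsilon> *\<^sub>R s powr p *\<^sub>R v" using loc[OF \<rho>(1) s v] \<rho>(2) by simp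
    ultimately show "F * v \<le> \<epsilon> *\<^sub>R ((1 + a ^ ?k) * v)" by (rule order_trans[rotated])
  qed (fact \<rho>)
qed (fact zero)

section \<open>Powers as suprema of tangents\<close>

definition power_tangent :: "real \<Rightarrow> real \<Rightarrow> 'a::phi_algebra \<Rightarrow> 'a" where
  "power_tangent p s a = (p * s powr (p - 1)) *\<^sub>R a - ((p - 1) * s powr p) *\<^sub>R 1"

text \<open>On a piece the tangent at \<open>t\<close> is at most its value at
  \<open>\<rho> * s\<close>, hence at most \<open>(\<rho> * s) powr p\<close>, while the power is at
  least \<open>s powr p\<close>. Off the support of \<open>a\<close> the tangent is
  nonpositive.\<close>

lemma power_tangent_le_lpow:
  fixes a :: "'a::phi_algebra"
  assumes ex: "roots_exist TYPE('a)" and a: "0 \<le> a" and p: "1 < p" and t: "0 < t"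
  shows "power_tangent p t a \<le> lpow a p"
proof -
  have "power_tangent p t a - lpow a p \<le> 0"
  proof (rule le_0_local_powr[OF a])
    fix \<rho> s :: real and v assume \<rho>: "1 < \<rho>" and s: "0 < s" and v: "between a s (\<rho> * s) v"
    have v0: "0 \<le> v" using v by (rule between_nonneg)
    have "(p * t powr (p - 1)) *\<^sub>R (a * v) \<le> (p * t powr (p - 1)) *\<^sub>R (\<rho> * s) *\<^sub>R v"
      using p by (intro scaleR_left_mono between_le[OF v]) auto
    then have "power_tangent p t a * v \<le> (p * t powr (p - 1) * (\<rho> * s) - (p - 1) * t powr p) *\<^sub>R v"
      by (simp add: power_tangent_def left_diff_distrib scaleR_left_diff_distrib)
    also have "\<dots> \<le> ((\<rho> * s) powr p) *\<^sub>R v"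
      using \<rho> s by (intro scaleR_right_mono v0 bernoulli_powr p t) auto
    also have "\<dots> \<le> (\<rho> ^ Suc (nat \<lfloor>p\<rfloor>) * s powr p) *\<^sub>R v"
    proof (intro scaleR_right_mono v0)
      have "\<rho> powr p \<le> \<rho> powr real (Suc (nat \<lfloor>p\<rfloor>))" using \<rho> p by (intro powr_mono) linarith+
      then have "\<rho> powr p \<le> \<rho> ^ Suc (nat \<lfloor>p\<rfloor>)" using \<rho> by (simp add: powr_realpow del: power_Suc of_nat_Suc)
      then show "(\<rho> * s) powr p \<le> \<rho> ^ Suc (nat \<lfloor>p\<rfloor>) * s powr p"
        using \<rho> s by (simp add: powr_mult mult_right_mono del: power_Suc)
    qed
    finally show "(power_tangent p t a - lpow a p) * v \<le> ((\<rho> ^ Suc (nat \<lfloor>p\<rfloor>) - 1) * s powr p) *\<^sub>R v"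
      using lpow_between(1)[OF ex a p \<rho> s v]
      by (simp add: left_diff_distrib scaleR_left_diff_distrib diff_mono del: power_Suc)
  next
    fix v assume v: "0 \<le> v" "inf a v = 0"
    have "power_tangent p t a * v = - (((p - 1) * t powr p) *\<^sub>R v)"
      using disjoint_mult[OF v(2)] by (simp add: power_tangent_def left_diff_distrib)
    moreover have "0 \<le> ((p - 1) * t powr p) *\<^sub>R v" using p v by (intro scaleR_nonneg_nonneg) auto
    moreover have "0 \<le> lpow a p * v" using p by (intro mult_nonneg lpow_nonneg ex a v) simp
    ultimately have "power_tangent p t a * v \<le> lpow a p * v" by (metis neg_le_0_iff_le order_trans)
    then show "(power_tangent p t a - lpow a p) * v \<le> 0" by (simp add: left_diff_distrib)
  qed (use p in simp)
  then show ?thesis by simp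
qed

text \<open>On the piece at \<open>s\<close> the tangent at that same \<open>s\<close> is at least
  \<open>s powr p\<close>, which is the power up to the permitted error. Off the support of
  \<open>a\<close>, tangents at small \<open>s\<close> force \<open>z\<close> to be nonnegative, and
  the power vanishes.\<close>

lemma lpow_le_if_power_tangent_le:
  fixes a z :: "'a::phi_algebra"
  assumes ex: "roots_exist TYPE('a)" and a: "0 \<le> a" and p: "1 < p"
    and z: "\<And>s. 0 < s \<Longrightarrow> power_tangent p s a \<le> z"
  shows "lpow a p \<le> z"
proof -
  have zv: "((p * s powr (p - 1)) *\<^sub>R (a * v) - ((p - 1) * s powr p) *\<^sub>R v) \<le> z * v" if "0 < s" "0 \<le> v" for s v
    using mult_right_mono[OF z[OF that(1)] that(2)] by (simp add: power_tangent_def left_diff_distrib)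
  have "lpow a p - z \<le> 0"
  proof (rule le_0_local_powr[OF a])
    fix \<rho> s :: real and v assume \<rho>: "1 < \<rho>" and s: "0 < s" and v: "between a s (\<rho> * s) v"
    have v0: "0 \<le> v" using v by (rule between_nonneg)
    have "s powr p *\<^sub>R v = (p * s powr (p - 1)) *\<^sub>R s *\<^sub>R v - ((p - 1) * s powr p) *\<^sub>R v"
      using s by (simp add: powr_diff algebra_simps)
    also have "\<dots> \<le> (p * s powr (p - 1)) *\<^sub>R (a * v) - ((p - 1) * s powr p) *\<^sub>R v"
      using p by (intro diff_mono scaleR_left_mono between_le[OF v]) auto
    also have "\<dots> \<le> z * v" by (rule zv[OF s v0])
    finally show "(lpow a p - z) * v \<le> ((\<rho> ^ Suc (nat \<lfloor>p\<rfloor>) - 1) * s powr p) *\<^sub>R v"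
      using lpow_between(2)[OF ex a p \<rho> s v]
      by (simp add: left_diff_distrib scaleR_left_diff_distrib diff_mono del: power_Suc)
  next
    fix v assume v: "0 \<le> v" "inf a v = 0"
    have av: "a * v = 0" by (rule disjoint_mult[OF v(2)])
    have "- (z * v) \<le> 0"
    proof (rule archimedean_Suc)
      fix n :: nat
      \<comment> \<open>Chosen so that \<open>?s powr p\<close> is
        \<open>1 / (n + 1)\<close>.\<close>
      let ?s = "inverse (of_nat (Suc n)) powr (1 / p) :: real"
      have "- (z * v) \<le> ((p - 1) * inverse (of_nat (Suc n))) *\<^sub>R v"
        using zv[of ?s v] v p by (simp add: av powr_powr minus_le_iff del: of_nat_Suc)
      then have "of_nat (Suc n) *\<^sub>R (- (z * v)) \<le> of_nat (Suc n) *\<^sub>R ((p - 1) * inverse (of_nat (Suc n))) *\<^sub>R v"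
        by (rule scaleR_left_mono) simp
      also have "\<dots> = (p - 1) *\<^sub>R v" by (simp del: of_nat_Suc)
      finally show "of_nat (Suc n) *\<^sub>R (- (z * v)) \<le> (p - 1) *\<^sub>R v" .
    qed (use p v in \<open>auto intro: scaleR_nonneg_nonneg\<close>)
    moreover have "lpow a p * v \<le> 0"
    proof -
      \<comment> \<open>As \<open>p > 1\<close>, there is at least one factor \<open>a\<close>, and
        it annihilates \<open>v\<close>.\<close>
      obtain m where m: "nat \<lfloor>p\<rfloor> = Suc m" using p by (cases "nat \<lfloor>p\<rfloor>") linarith+
      have "lpow a p * v = a ^ Suc m * (lpow a (frac p) * v)"
        using p by (simp add: lpow_eq[of p] m mult.assoc)
      also have "\<dots> \<le> a ^ Suc m * (root_tangent (frac p) 1 a * v)"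
        by (intro mult_left_mono mult_right_mono lpow_root_bounds[OF ex a] v power_nonneg a)
          (auto simp: frac_lt_1)
      also have "\<dots> = 0"
        by (simp add: root_tangent_def distrib_right av power_Suc2 mult.assoc del: power_Suc)
      finally show ?thesis .
    qed
    ultimately show "(lpow a p - z) * v \<le> 0" by (simp add: left_diff_distrib)
  qed (use p in simp)
  then show ?thesis by simp
qed

section \<open>From tangents to Minkowski's inequality for positive elements\<close>

lemma lpow_mono:
  fixes a b :: "'a::phi_algebra"
  assumes "roots_exist TYPE('a)" "0 \<le> a" "a \<le> b" "1 < p"
  shows "lpow a p \<le> lpow b p"
proof (rule lpow_le_if_power_tangent_le)
  fix s :: real assume s: "0 < s"
  have "power_tangent p s a \<le> power_tangent p s b"
    using assms by (auto simp: power_tangent_def intro!: scaleR_left_mono)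
  also have "\<dots> \<le> lpow b p"
    using assms s by (intro power_tangent_le_lpow) auto
  finally show "power_tangent p s a \<le> lpow b p" .
qed (use assms in auto)

text \<open>The tangent at \<open>s\<close> of the left-hand side is a combination of those of \<open>a\<^sup>p\<close> at \<open>\<alpha> s\<close> and of
  \<open>b\<^sup>p\<close> at \<open>(1 - \<alpha>) s\<close>.\<close>

lemma lpow_add_le:
  fixes a b :: "'a::phi_algebra"
  assumes ex: "roots_exist TYPE('a)" and "0 \<le> a" "0 \<le> b" "1 < p" "0 < \<alpha>" "\<alpha> < 1"
  shows "lpow (a + b) p \<le> \<alpha> powr (1 - p) *\<^sub>R lpow a p + (1 - \<alpha>) powr (1 - p) *\<^sub>R lpow b p"
proof (rule lpow_le_if_power_tangent_le[OF ex])
  fix s :: real assume s: "0 < s"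
  \<comment> \<open>The weight makes the coefficient of \<open>x\<close> independent of
    \<open>\<mu>\<close> and the constant proportional to \<open>\<mu>\<close>, so the constants for
    \<open>\<alpha>\<close> and \<open>1 - \<alpha>\<close> add up correctly.\<close>
  have scale: "\<mu> powr (1 - p) *\<^sub>R power_tangent p (\<mu> * s) x
      = (p * s powr (p - 1)) *\<^sub>R x - (\<mu> * ((p - 1) * s powr p)) *\<^sub>R 1"
    if "0 < \<mu>" for \<mu> and x :: 'a
  proof -
    have "\<mu> powr (1 - p) * (p * (\<mu> * s) powr (p - 1)) = p * s powr (p - 1)"
      "\<mu> powr (1 - p) * ((p - 1) * (\<mu> * s) powr p) = \<mu> * ((p - 1) * s powr p)"
      using that s by (simp_all add: powr_mult powr_diff field_simps)
    then show ?thesis by (simp only: power_tangent_def scaleR_right_diff_distrib scaleR_scaleR)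
  qed
  have "power_tangent p s (a + b)
      = \<alpha> powr (1 - p) *\<^sub>R power_tangent p (\<alpha> * s) a + (1 - \<alpha>) powr (1 - p) *\<^sub>R power_tangent p ((1 - \<alpha>) * s) b"
    using assms(6) by (simp only: scale[OF assms(5)] scale[of "1 - \<alpha>"] diff_gt_0_iff_gt)
      (simp add: power_tangent_def algebra_simps)
  also have "\<dots> \<le> \<alpha> powr (1 - p) *\<^sub>R lpow a p + (1 - \<alpha>) powr (1 - p) *\<^sub>R lpow b p"
    using assms s by (intro add_mono scaleR_left_mono power_tangent_le_lpow) auto
  finally show "power_tangent p s (a + b) \<le> \<dots>" .
qed (use assms in auto)

text \<open>For positive scalars with \<open>p\<close>-th roots \<open>U\<close> and
  \<open>V\<close>, the bound is least at \<open>\<alpha> = U / (U + V)\<close>, with value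
  \<open>(U + V) powr p\<close>. For elements this \<open>\<alpha>\<close> would vary from point to
  point, so it is formed from the tangency points \<open>s\<close> and \<open>t\<close>
  instead.\<close>

lemma lpow_root_add_le:
  fixes u v y :: "'a::phi_algebra"
  assumes ex: "roots_exist TYPE('a)" and u: "0 \<le> u" and v: "0 \<le> v" and y: "0 \<le> y" and p: "1 < p"
    and le: "\<And>\<alpha>. 0 < \<alpha> \<Longrightarrow> \<alpha> < 1 \<Longrightarrow> y \<le> \<alpha> powr (1 - p) *\<^sub>R u + (1 - \<alpha>) powr (1 - p) *\<^sub>R v"
  shows "lpow y (1 / p) \<le> lpow u (1 / p) + lpow v (1 / p)"
proof -
  let ?r = "1 / p"
  have r: "0 < ?r" "?r < 1" using p by auto
  have st: "lpow y ?r \<le> root_tangent ?r s u + root_tangent ?r t v" if "0 < s" "0 < t" for s t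
  proof -
    define S T where "S = s powr ?r" and "T = t powr ?r"
    \<comment> \<open>With \<open>\<alpha> = S / (S + T)\<close>, the tangent at \<open>q\<close> of
      the bound on \<open>y\<close> splits exactly into those of \<open>u\<close> at
      \<open>s\<close> and \<open>v\<close> at \<open>t\<close>.\<close>
    define q where "q = (S + T) powr p"
    have ST: "0 < S" "0 < T" using that by (auto simp: S_def T_def)
    then have q: "0 < q" by (simp add: q_def)
    have qr: "q powr ?r = S + T" using p ST by (simp add: q_def powr_powr)
    have qr1: "q powr (?r - 1) = (S + T) powr (1 - p)"
      using p by (simp add: q_def powr_powr right_diff_distrib)
    have weight: "q powr (?r - 1) * (X / (S + T)) powr (1 - p) = x powr (?r - 1)"
      if "0 < x" "X = x powr ?r" for x X
      using that p ST by (simp add: qr1 powr_divide powr_powr left_diff_distrib)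
        (simp add: diff_divide_distrib powr_diff)
    have weights: "(?r * q powr (?r - 1)) * (S / (S + T)) powr (1 - p) = ?r * s powr (?r - 1)"
      "(?r * q powr (?r - 1)) * (T / (S + T)) powr (1 - p) = ?r * t powr (?r - 1)"
      using weight[OF that(1) S_def] weight[OF that(2) T_def] by simp_all
    have T: "1 - S / (S + T) = T / (S + T)" using ST by (simp add: field_simps)
    have "lpow y ?r \<le> root_tangent ?r q y" by (rule lpow_le_root_tangent[OF ex y r q])
    also have "\<dots> \<le> root_tangent ?r q ((S / (S + T)) powr (1 - p) *\<^sub>R u + (T / (S + T)) powr (1 - p) *\<^sub>R v)"
      using le[of "S / (S + T)"] ST r unfolding root_tangent_def T
      by (intro add_right_mono scaleR_left_mono) auto
    also have "\<dots> = root_tangent ?r s u + root_tangent ?r t v"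
      by (simp only: root_tangent_def scaleR_right_distrib scaleR_scaleR weights qr)
        (simp add: S_def T_def algebra_simps)
    finally show ?thesis .
  qed
  have "lpow y ?r - root_tangent ?r t v \<le> lpow u ?r" if "0 < t" for t
    using st[OF _ that] by (intro lpow_greatest[OF ex u r]) (simp add: diff_le_eq)
  then have "lpow y ?r - lpow u ?r \<le> lpow v ?r"
    by (intro lpow_greatest[OF ex v r]) (simp add: algebra_simps)
  then show ?thesis by (simp add: algebra_simps)
qed

text \<open>Allowing any positive \<open>y\<close> below the sum leaves only the triangle inequality
  of the modulus to be supplied for each scalar field.\<close>

lemma minkowski:
  fixes S :: "'a::phi_algebra \<Rightarrow> 'b::phi_algebra" and n :: nat
  assumes exA: "roots_exist TYPE('a)" and exB: "roots_exist TYPE('b)" and p: "1 < p"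
    and S: "linear S" and pos: "\<And>x. 0 \<le> x \<Longrightarrow> 0 \<le> S x"
    and n: "1 \<le> n" and x: "\<And>k. k < n \<Longrightarrow> 0 \<le> x k" and y: "0 \<le> y" "y \<le> (\<Sum>k<n. x k)"
  shows "lpow (S (lpow y p)) (1 / p) \<le> (\<Sum>k<n. lpow (S (lpow (x k) p)) (1 / p))"
proof -
  interpret S: linear S by fact
  have mono: "S a \<le> S b" if "a \<le> b" for a b
    using pos[of "b - a"] that by (simp add: S.diff)
  define N where "N a = lpow (S (lpow a p)) (1 / p)" for a
  have nonneg: "0 \<le> S (lpow a p)" if "0 \<le> a" for a
    using p that by (intro pos lpow_nonneg exA) auto
  have N_mono: "N a \<le> N b" if "0 \<le> a" "a \<le> b" for a b
    unfolding N_def using p that by (intro lpow_root_mono exB nonneg mono lpow_mono exA) auto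
  have N_add: "N (a + b) \<le> N a + N b" if "0 \<le> a" "0 \<le> b" for a b
    unfolding N_def
  proof (rule lpow_root_add_le[OF exB nonneg nonneg nonneg p])
    fix \<alpha> :: real assume "0 < \<alpha>" "\<alpha> < 1"
    from mono[OF lpow_add_le[OF exA that p this]]
    show "S (lpow (a + b) p) \<le> \<alpha> powr (1 - p) *\<^sub>R S (lpow a p) + (1 - \<alpha>) powr (1 - p) *\<^sub>R S (lpow b p)"
      by (simp add: S.add S.scaleR)
  qed (use that in auto)
  \<comment> \<open>The induction starts at \<open>n = 1\<close>, where both sides agree.\<close>
  have "N (\<Sum>k<n. x k) \<le> (\<Sum>k<n. N (x k))"
    using n x
  proof (induction n rule: nat_induct_at_least)
    case (Suc n)
    have "N (\<Sum>k<Suc n. x k) \<le> N (\<Sum>k<n. x k) + N (x n)"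
      using N_add[of "\<Sum>k<n. x k" "x n"] sum_nonneg[of "{..<n}" x] Suc.prems by simp
    also have "\<dots> \<le> (\<Sum>k<n. N (x k)) + N (x n)" using Suc by simp
    finally show ?case by simp
  qed simp
  with N_mono[OF y] show ?thesis by (simp add: N_def)
qed

section \<open>The real modulus, and roots from weighted geometric means\<close>

lemma lmod_nonneg: "0 \<le> lmod a" for a :: "'a::phi_algebra"
proof -
  have "0 \<le> lmod a + lmod a"
    using add_mono[of a "lmod a" "- a" "lmod a"] by (simp_all add: lmod_def)
  then show ?thesis by (simp only: zero_le_double_add_iff_zero_le_single_add)
qed

lemma lmod_eq: "lmod a = a" if "0 \<le> a" for a :: "'a::phi_algebra"
proof -
  have "- a \<le> 0" using that by simp
  also note that
  finally show ?thesis by (simp add: lmod_def sup_absorb1)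
qed

lemma rpos_iff: "a \<in> rpos \<longleftrightarrow> 0 \<le> a" for a :: "'a::phi_algebra"
proof
  assume "a \<in> rpos"
  then have "lmod a = a" by (simp add: rpos_def)
  then show "0 \<le> a" using lmod_nonneg[of a] by simp
qed (simp add: rpos_def lmod_eq)

text \<open>Closedness is applied to preimages of \<open>a\<close> and \<open>1\<close> under
  \<open>M\<close>, with weights \<open>r\<close> and \<open>1 - r\<close>. Keeping \<open>M\<close>
  abstract covers both moduli.\<close>

lemma roots_exist_if_wgm_closed:
  fixes M :: "'x \<Rightarrow> 'a::phi_algebra"
  assumes wgm: "wgm_closed M" and M: "\<And>a. 0 \<le> a \<Longrightarrow> \<exists>x. M x = a"
  shows "roots_exist TYPE('a)"
  unfolding roots_exist_def
proof (intro allI impI)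
  fix a :: 'a and r :: real assume a: "0 \<le> a" and r: "0 < r" "r < 1"
  obtain x e where xe: "M x = a" "M e = 1" using M[OF a] M[OF one_nonneg] by blast
  define f \<omega> where "f k = (if k = 0 then x else e)" and "\<omega> k = (if k = 0 then r else 1 - r)" for k :: nat
  have two: "{..<2} = {0, 1::nat}" by auto
  have all2: "(\<forall>k<2. P k) \<longleftrightarrow> P 0 \<and> P 1" for P :: "nat \<Rightarrow> bool"
    by (metis One_nat_def less_2_cases_iff)
  have family: "(\<Sum>k<2. (\<omega> k * \<theta> k) *\<^sub>R M (f k)) = (r * \<theta> 0) *\<^sub>R a + ((1 - r) * \<theta> 1) *\<^sub>R 1"
    "(\<Prod>k<2. \<theta> k powr \<omega> k) = \<theta> 0 powr r * \<theta> 1 powr (1 - r)" for \<theta>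
    by (simp_all add: two f_def \<omega>_def xe)
  have "{\<Sum>k<2. (\<omega> k * \<theta> k) *\<^sub>R M (f k) | \<theta>. (\<forall>k<2. \<theta> k > 0) \<and> (\<Prod>k<2. \<theta> k powr \<omega> k) = 1}
    = {(r * t1) *\<^sub>R a + ((1 - r) * t2) *\<^sub>R 1 | t1 t2. t1 > 0 \<and> t2 > 0 \<and> t1 powr r * t2 powr (1 - r) = 1}"
    (is "?L = ?R")
  proof (rule antisym; rule subsetI)
    fix z assume "z \<in> ?R"
    then obtain t1 t2 where "z = (r * t1) *\<^sub>R a + ((1 - r) * t2) *\<^sub>R 1"
      "t1 > 0" "t2 > 0" "t1 powr r * t2 powr (1 - r) = 1" by blast
    then show "z \<in> ?L" unfolding family all2 mem_Collect_eq
      by - (rule exI[of _ "\<lambda>k. if k = 0 then t1 else t2"], simp)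
  next
    fix z assume "z \<in> ?L"
    then show "z \<in> ?R" unfolding family all2 mem_Collect_eq by blast
  qed
  moreover have "(\<forall>k<2. 0 < \<omega> k \<and> \<omega> k < 1) \<and> (\<Sum>k<2. \<omega> k) = 1"
    using r by (simp add: \<omega>_def two)
  then have "\<exists>s. is_inf {\<Sum>k<2. (\<omega> k * \<theta> k) *\<^sub>R M (f k) | \<theta>. (\<forall>k<2. \<theta> k > 0) \<and> (\<Prod>k<2. \<theta> k powr \<omega> k) = 1} s"
    by (rule wgm[unfolded wgm_closed_def, THEN spec[of _ 2], THEN spec[of _ f], THEN spec[of _ \<omega>], THEN mp])
  ultimately show "\<exists>c. is_inf {root_tangent r s a | s. 0 < s} c" by (simp only: root_tangent_set[OF r])
qed

lemma lmod_sum_le: "lmod (\<Sum>k\<in>I. a k) \<le> (\<Sum>k\<in>I. lmod (a k))" for a :: "'i \<Rightarrow> 'a::phi_algebra"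
  unfolding lmod_def by (rule sup_least) (auto simp flip: sum_negf intro!: sum_mono)

section \<open>The complex modulus\<close>

lemma is_sup_unique: "is_sup S x \<Longrightarrow> is_sup S y \<Longrightarrow> x = y"
  by (auto simp: is_sup_def intro: antisym)

lemma is_sup_cmodE:
  fixes x :: "'a::phi_algebra \<times> 'a"
  assumes "complexifiable TYPE('a)"
  shows "is_sup (cmod_set (fst x) (snd x)) (cmodE x)"
proof -
  obtain s where s: "is_sup (cmod_set (fst x) (snd x)) s"
    using assms unfolding complexifiable_def by blast
  then have "cmodE x = s" unfolding cmodE_def using is_sup_unique by blast
  with s show ?thesis by simp
qed

lemma cmodE_nonneg:
  fixes x :: "'a::phi_algebra \<times> 'a"
  assumes "complexifiable TYPE('a)"
  shows "0 \<le> cmodE x"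
proof -
  have ub: "cos \<theta> *\<^sub>R fst x + sin \<theta> *\<^sub>R snd x \<le> cmodE x" if "0 \<le> \<theta>" "\<theta> \<le> 2 * pi" for \<theta>
    using is_sup_cmodE[OF assms, of x] that by (auto simp: is_sup_def cmod_set_def)
  \<comment> \<open>The angles \<open>0\<close> and \<open>pi\<close> give the real part and its
    negative.\<close>
  have "0 \<le> cmodE x + cmodE x"
    using add_mono[OF ub[of 0] ub[of pi]] by simp_all
  then show ?thesis by (simp only: zero_le_double_add_iff_zero_le_single_add)
qed

text \<open>For each angle the rotated real part is additive, hence at most the sum of the two
  moduli.\<close>

lemma cmodE_add_le:
  fixes x y :: "'a::phi_algebra \<times> 'a"
  assumes "complexifiable TYPE('a)"
  shows "cmodE (x + y) \<le> cmodE x + cmodE y"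
proof -
  note sup = is_sup_cmodE[OF assms, unfolded is_sup_def]
  have ub: "cos \<theta> *\<^sub>R fst z + sin \<theta> *\<^sub>R snd z \<le> cmodE z" if "0 \<le> \<theta>" "\<theta> \<le> 2 * pi" for \<theta> and z :: "'a \<times> 'a"
    using sup[of z] that by (auto simp: cmod_set_def)
  have "cos \<theta> *\<^sub>R fst (x + y) + sin \<theta> *\<^sub>R snd (x + y) \<le> cmodE x + cmodE y"
    if "0 \<le> \<theta>" "\<theta> \<le> 2 * pi" for \<theta>
    using add_mono[OF ub[OF that, of x] ub[OF that, of y]] by (simp add: scaleR_right_distrib add_ac)
  then have "\<forall>u\<in>cmod_set (fst (x + y)) (snd (x + y)). u \<le> cmodE x + cmodE y"
    by (auto simp: cmod_set_def)
  then show ?thesis using sup[of "x + y"] by blast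
qed

lemma cmodE_of_real:
  fixes f :: "'a::phi_algebra"
  assumes "complexifiable TYPE('a)" "0 \<le> f"
  shows "cmodE (f, 0) = f"
proof (rule is_sup_unique[OF is_sup_cmodE[OF assms(1)]])
  have "cos \<theta> *\<^sub>R f \<le> f" for \<theta>
    using scaleR_right_mono[OF cos_le_one assms(2)] by simp
  moreover have "f \<in> cmod_set f 0" by (auto simp: cmod_set_def intro!: exI[of _ 0])
  ultimately show "is_sup (cmod_set (fst (f, 0)) (snd (f, 0))) f"
    by (auto simp: is_sup_def cmod_set_def)
qed

lemma cmodE_sum_le:
  fixes a :: "nat \<Rightarrow> 'a::phi_algebra \<times> 'a"
  assumes "complexifiable TYPE('a)"
  shows "cmodE (\<Sum>k<n. a k) \<le> (\<Sum>k<n. cmodE (a k))"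
proof (induction n)
  case 0
  then show ?case using cmodE_of_real[OF assms order_refl] by (simp add: zero_prod_def)
next
  case (Suc n)
  have "cmodE (\<Sum>k<Suc n. a k) \<le> cmodE (\<Sum>k<n. a k) + cmodE (a n)"
    using cmodE_add_le[OF assms, of "\<Sum>k<n. a k" "a n"] by simp
  also have "\<dots> \<le> (\<Sum>k<Suc n. cmodE (a k))" using Suc by simp
  finally show ?case .
qed

lemma cpos_iff:
  fixes x :: "'a::phi_algebra \<times> 'a"
  assumes "complexifiable TYPE('a)"
  shows "x \<in> cpos \<longleftrightarrow> 0 \<le> fst x \<and> snd x = 0"
  using cmodE_of_real[OF assms, of "fst x"] cmodE_nonneg[OF assms, of x]
  by (cases x) (auto simp: cpos_def cmodC_def)

section \<open>Transfer to real and complex scalars\<close>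

theorem theorem5p1:
  shows "(\<forall>(T::'a::phi_algebra \<Rightarrow> 'b::phi_algebra) (p::real) (n::nat) (a::nat \<Rightarrow> 'a).
            wgm_closed (lmod :: 'a \<Rightarrow> 'a) \<and> wgm_closed (lmod :: 'b \<Rightarrow> 'b) \<and>
            1 < p \<and> linear T \<and> T ` rpos \<subseteq> rpos \<and> 1 \<le> n \<longrightarrow>
            lpow (T (lpow (lmod (\<Sum>k<n. a k)) p)) (1 / p)
              \<le> (\<Sum>k<n. lpow (T (lpow (lmod (a k)) p)) (1 / p)))
       \<and> (\<forall>(T::'a \<times> 'a \<Rightarrow> 'b \<times> 'b) (p::real) (n::nat) (a::nat \<Rightarrow> 'a \<times> 'a).
            complexifiable TYPE('a) \<and> complexifiable TYPE('b) \<and>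
            wgm_closed (cmodE :: 'a \<times> 'a \<Rightarrow> 'a) \<and> wgm_closed (cmodE :: 'b \<times> 'b \<Rightarrow> 'b) \<and>
            1 < p \<and> clinear_map T \<and> T ` cpos \<subseteq> cpos \<and> 1 \<le> n \<longrightarrow>
            cle (cpow (T (cpow (cmodC (\<Sum>k<n. a k)) p)) (1 / p))
                (\<Sum>k<n. cpow (T (cpow (cmodC (a k)) p)) (1 / p)))"
proof (intro conjI allI impI; elim conjE)
  fix T :: "'a \<Rightarrow> 'b" and p :: real and n :: nat and a :: "nat \<Rightarrow> 'a"
  assume A: "wgm_closed (lmod :: 'a \<Rightarrow> 'a)" "wgm_closed (lmod :: 'b \<Rightarrow> 'b)"
    and p: "1 < p" and T: "linear T" "T ` rpos \<subseteq> rpos" and n: "1 \<le> n"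
  have ex: "roots_exist TYPE('a)"
    by (rule roots_exist_if_wgm_closed[OF A(1)]) (rule exI, erule lmod_eq)
  have ex': "roots_exist TYPE('b)"
    by (rule roots_exist_if_wgm_closed[OF A(2)]) (rule exI, erule lmod_eq)
  have pos: "0 \<le> T x" if "0 \<le> x" for x
    using T(2) that rpos_iff[of x] rpos_iff[of "T x"] by blast
  show "lpow (T (lpow (lmod (\<Sum>k<n. a k)) p)) (1 / p) \<le> (\<Sum>k<n. lpow (T (lpow (lmod (a k)) p)) (1 / p))"
    by (rule minkowski[OF ex ex' p T(1) pos n lmod_nonneg lmod_nonneg lmod_sum_le])
next
  fix T :: "'a \<times> 'a \<Rightarrow> 'b \<times> 'b" and p :: real and n :: nat and a :: "nat \<Rightarrow> 'a \<times> 'a"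
  assume cx: "complexifiable TYPE('a)" "complexifiable TYPE('b)"
    and A: "wgm_closed (cmodE :: 'a \<times> 'a \<Rightarrow> 'a)" "wgm_closed (cmodE :: 'b \<times> 'b \<Rightarrow> 'b)"
    and p: "1 < p" and T: "clinear_map T" "T ` cpos \<subseteq> cpos" and n: "1 \<le> n"
  have ex: "roots_exist TYPE('a)"
    by (rule roots_exist_if_wgm_closed[OF A(1)]) (rule exI, erule cmodE_of_real[OF cx(1)])
  have ex': "roots_exist TYPE('b)"
    by (rule roots_exist_if_wgm_closed[OF A(2)]) (rule exI, erule cmodE_of_real[OF cx(2)])
  \<comment> \<open>\<open>T\<close> on real elements, followed by the first component. Since
    \<open>cpow\<close> reads only that component, \<open>S\<close> can replace \<open>T\<close> in
    the inequality.\<close>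
  define S where "S f = fst (T (f, 0))" for f
  have add: "T (x + y) = T x + T y" and scale: "T (cscale c x) = cscale c (T x)" for x y c
    using T(1) unfolding clinear_map_def by blast+
  have S: "linear S"
  proof
    show "S (x + y) = S x + S y" for x y using add[of "(x, 0)" "(y, 0)"] by (simp add: S_def)
    show "S (r *\<^sub>R x) = r *\<^sub>R S x" for r x
      using scale[of "of_real r" "(x, 0)"] by (simp add: S_def cscale_def)
  qed
  have pos: "0 \<le> S f" if "0 \<le> f" for f
  proof -
    have "(f, 0) \<in> cpos" using that by (simp add: cpos_iff[OF cx(1)])
    then have "T (f, 0) \<in> cpos" using T(2) by blast
    then show ?thesis by (simp add: cpos_iff[OF cx(2)] S_def)
  qed
  have "lpow (S (lpow (cmodE (\<Sum>k<n. a k)) p)) (1 / p) \<le> (\<Sum>k<n. lpow (S (lpow (cmodE (a k)) p)) (1 / p))"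
    by (rule minkowski[OF ex ex' p S pos n cmodE_nonneg[OF cx(1)] cmodE_nonneg[OF cx(1)] cmodE_sum_le[OF cx(1)]])
  then show "cle (cpow (T (cpow (cmodC (\<Sum>k<n. a k)) p)) (1 / p)) (\<Sum>k<n. cpow (T (cpow (cmodC (a k)) p)) (1 / p))"
    by (simp add: cle_def cpow_def cmodC_def S_def fst_sum snd_sum)
qed

end
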